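(* Let $T\subset\mathbb{R}^2$ be a (nondegenerate) triangle of area $1$. Then for every $0\le t\le 1/4$ there are two orthogonal lines cutting $T$ into four pieces whose areas, in cyclic order, are $$t,\quad t,\quad \tfrac12-t,\quad \tfrac12-t .$$
   Context: The pieces are the intersections of $T$ with the four quadrant-shaped regions determined by the two orthogonal lines, listed in cyclic order around their intersection point. Convention: at $t=0$ the degenerate partition given by a single line halving the area is allowed. *)

theory Defs
  imports "HOL-Analysis.Analysis"
begin

definition line :: "real ^ 2 \<Rightarrow> real ^ 2 \<Rightarrow> (real ^ 2) set" where
  "line p d = {p + s *\<^sub>R d | s. True}"

definition quadrant :: "real ^ 2 \<Rightarrow> real ^ 2 \<Rightarrow> real ^ 2 \<Rightarrow> (real ^ 2) set" where
  "quadrant p u v = {x. 0 \<le> (x - p) \<bullet> u \<and> 0 \<le> (x - p) \<bullet> v}"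

text \<open>
  The orthogonal lines \<open>L\<close> and \<open>M\<close>, meeting at \<open>p\<close>, cut \<open>T\<close> into the pieces
  \<open>A\<close>, \<open>B\<close>, \<open>C\<close>, \<open>D\<close>, listed in cyclic order around \<open>p\<close>: consecutive sign patterns
  of the coordinates along \<open>u\<close> and \<open>v\<close> differ in exactly one place. As \<open>u\<close> and \<open>v\<close>
  may be negated and exchanged, every starting piece and both senses of rotation occur.
  The pieces are closed and so overlap along \<open>L\<close> and \<open>M\<close>, which are null sets. A piece
  may be null or empty: if one of the lines misses \<open>T\<close>, this is the degenerate
  partition of \<open>T\<close> by the other line alone.
\<close>

definition orthogonal_cut ::
  "(real ^ 2) set \<Rightarrow> (real ^ 2) set \<Rightarrow> (real ^ 2) set \<Rightarrow>
   (real ^ 2) set \<Rightarrow> (real ^ 2) set \<Rightarrow> (real ^ 2) set \<Rightarrow> (real ^ 2) set \<Rightarrow> bool" where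
  "orthogonal_cut T L M A B C D \<longleftrightarrow>
     (\<exists>p u v. u \<noteq> 0 \<and> v \<noteq> 0 \<and> orthogonal u v \<and> L = line p u \<and> M = line p v \<and>
        A = T \<inter> quadrant p u v \<and>
        B = T \<inter> quadrant p (- u) v \<and>
        C = T \<inter> quadrant p (- u) (- v) \<and>
        D = T \<inter> quadrant p u (- v))"

end

theory Submission
  imports Defs
begin

text \<open>
  For a direction \<open>u\<close>, take the line normal to \<open>u\<close> that halves \<open>T\<close>, and the line parallel to \<open>u\<close>
  that cuts off a cap of area \<open>2 t\<close>. It suffices to find a \<open>u\<close> for which the first line also halves
  the cap. Let \<open>C\<close> be the vertex opposite the longest side, and turn \<open>u\<close> from \<open>C - B\<close> to \<open>A - C\<close>,
  so that the cap moves from the side \<open>BC\<close> to the side \<open>CA\<close>. As \<open>AB\<close> is longest, at both ends the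
  part of the cap away from \<open>C\<close> is the larger one; but \<open>u\<close> points to \<open>C\<close> at the start and away from it
  at the end, so the intermediate value theorem applies.
\<close>

section \<open>Areas of wedges: continuity and additivity\<close>

text \<open>Normals and levels enter separately, without a corner point, so that each can vary
  continuously. Negating a normal together with its level gives the opposite closed
  half-space.\<close>

definition wedge_cut :: "'a::euclidean_space set \<Rightarrow> 'a \<Rightarrow> real \<Rightarrow> 'a \<Rightarrow> real \<Rightarrow> 'a set" where
  "wedge_cut T u m v k = T \<inter> {x. m \<le> x \<bullet> u} \<inter> {x. k \<le> x \<bullet> v}"

lemma compact_wedge_cut: "compact T \<Longrightarrow> compact (wedge_cut T u m v k)"
  unfolding wedge_cut_def
  by (intro compact_Int_closed closed_Collect_le continuous_intros)

text \<open>Off the limiting hyperplane the sign of \<open>x \<bullet> u0 - m0\<close> is strict, so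
  it persists for late indices and the indicator is eventually constant.\<close>

lemma tendsto_indicator_halfspace:
  fixes u :: "nat \<Rightarrow> 'a::euclidean_space"
  assumes "u \<longlonglongrightarrow> u0" "m \<longlonglongrightarrow> m0" "x \<bullet> u0 \<noteq> m0"
  shows "(\<lambda>n. indicat_real {x. m n \<le> x \<bullet> u n} x) \<longlonglongrightarrow> indicat_real {x. m0 \<le> x \<bullet> u0} x"
proof -
  have lim: "(\<lambda>n. x \<bullet> u n - m n) \<longlonglongrightarrow> x \<bullet> u0 - m0"
    by (intro tendsto_intros assms)
  show ?thesis
  proof (cases "x \<bullet> u0 - m0 > 0")
    case True
    have "\<forall>\<^sub>F n in sequentially. x \<bullet> u n - m n > 0"
      using order_tendstoD(1)[OF lim True] .
    then have "\<forall>\<^sub>F n in sequentially. indicat_real {x. m n \<le> x \<bullet> u n} x = indicat_real {x. m0 \<le> x \<bullet> u0} x"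
      by eventually_elim (use True in \<open>auto simp: indicator_def\<close>)
    then show ?thesis by (rule tendsto_eventually)
  next
    case False
    then have neg: "x \<bullet> u0 - m0 < 0" using assms(3) by simp
    have "\<forall>\<^sub>F n in sequentially. x \<bullet> u n - m n < 0"
      using order_tendstoD(2)[OF lim neg] .
    then have "\<forall>\<^sub>F n in sequentially. indicat_real {x. m n \<le> x \<bullet> u n} x = indicat_real {x. m0 \<le> x \<bullet> u0} x"
      by eventually_elim (use neg in \<open>auto simp: indicator_def\<close>)
    then show ?thesis by (rule tendsto_eventually)
  qed
qed

lemma AE_not_hyperplane:
  fixes u :: "'a::euclidean_space"
  assumes "u \<noteq> 0"
  shows "AE x in lebesgue. x \<bullet> u \<noteq> m"
proof -
  have "negligible {x. u \<bullet> x = m}"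
    using assms by (intro negligible_hyperplane) auto
  then have "{x. u \<bullet> x = m} \<in> null_sets lebesgue"
    by (simp add: negligible_iff_null_sets)
  from AE_not_in[OF this] show ?thesis by (simp add: inner_commute)
qed

text \<open>Dominated convergence for the indicators: they converge off the two limiting
  hyperplanes, which are null because the normals are nonzero, and are bounded by the indicator of
  \<open>T\<close>.\<close>

lemma continuous_on_measure_wedge_cut:
  fixes T :: "'a::euclidean_space set" and u v :: "'b::metric_space \<Rightarrow> 'a"
  assumes T: "compact T"
    and cont: "continuous_on S u" "continuous_on S v" "continuous_on S m" "continuous_on S k"
    and nz: "\<And>s. s \<in> S \<Longrightarrow> u s \<noteq> 0" "\<And>s. s \<in> S \<Longrightarrow> v s \<noteq> 0"
  shows "continuous_on S (\<lambda>s. measure lebesgue (wedge_cut T (u s) (m s) (v s) (k s)))"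
proof (rule continuous_on_sequentiallyI)
  fix X a assume X: "\<forall>n. X n \<in> S" "a \<in> S" "X \<longlonglongrightarrow> a"
  have lim: "(\<lambda>n. f (X n)) \<longlonglongrightarrow> f a" if "continuous_on S f" for f :: "'b \<Rightarrow> 'c::topological_space"
    using that X by (auto simp: continuous_on_sequentially o_def)
  have cmp: "wedge_cut T (u s) (m s) (v s) (k s) \<in> lmeasurable" for s
    by (intro lmeasurable_compact compact_wedge_cut T)
  have eq: "measure lebesgue (wedge_cut T (u s) (m s) (v s) (k s))
      = integral\<^sup>L lebesgue (indicat_real (wedge_cut T (u s) (m s) (v s) (k s)))" for s
    by simp
  have "AE x in lebesgue. (\<lambda>n. indicat_real (wedge_cut T (u (X n)) (m (X n)) (v (X n)) (k (X n))) x)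
      \<longlonglongrightarrow> indicat_real (wedge_cut T (u a) (m a) (v a) (k a)) x"
    using AE_not_hyperplane[OF nz(1)[OF X(2)], of "m a"] AE_not_hyperplane[OF nz(2)[OF X(2)], of "k a"]
  proof eventually_elim
    case (elim x)
    show ?case
      unfolding wedge_cut_def indicator_inter_arith
      by (intro tendsto_mult tendsto_const tendsto_indicator_halfspace lim cont elim)
  qed
  then show "(\<lambda>n. measure lebesgue (wedge_cut T (u (X n)) (m (X n)) (v (X n)) (k (X n))))
      \<longlonglongrightarrow> measure lebesgue (wedge_cut T (u a) (m a) (v a) (k a))"
    unfolding eq
  proof (rule integral_dominated_convergence[rotated 3, where w = "indicat_real T"])
    show "AE x in lebesgue. norm (indicat_real (wedge_cut T (u (X n)) (m (X n)) (v (X n)) (k (X n))) x)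
        \<le> indicat_real T x" for n
      by (auto simp: wedge_cut_def indicator_def)
    show "integrable lebesgue (indicat_real T)"
      using lmeasurable_compact[OF T] by (simp add: lmeasurable_iff_integrable)
  qed (use cmp in \<open>auto simp: fmeasurableD\<close>)
qed

text \<open>The two wedges overlap only in a null hyperplane. With \<open>v = 0\<close> and
  \<open>k = 0\<close> the second condition is vacuous, and the equation splits \<open>T\<close>
  itself.\<close>

lemma measure_wedge_cut_split:
  fixes T :: "'a::euclidean_space set"
  assumes T: "compact T" and u: "u \<noteq> 0"
  shows "measure lebesgue (wedge_cut T u m v k) + measure lebesgue (wedge_cut T (- u) (- m) v k)
    = measure lebesgue (T \<inter> {x. k \<le> x \<bullet> v})"
proof -
  let ?A = "wedge_cut T u m v k" and ?B = "wedge_cut T (- u) (- m) v k"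
  have m: "?A \<in> lmeasurable" "?B \<in> lmeasurable"
    by (intro lmeasurable_compact compact_wedge_cut T)+
  have "negligible {x. u \<bullet> x = m}"
    using u by (intro negligible_hyperplane) auto
  then have "negligible (?A \<inter> ?B)"
    by (rule negligible_subset) (auto simp: wedge_cut_def inner_commute)
  moreover have "?A \<union> ?B = T \<inter> {x. k \<le> x \<bullet> v}"
    by (auto simp: wedge_cut_def)
  ultimately show ?thesis
    using measure_Un3[OF m] negligible_imp_measure0 by fastforce
qed

lemma wedge_cut_commute: "wedge_cut T u m v k = wedge_cut T v k u m"
  by (auto simp: wedge_cut_def)

section \<open>Half-spaces that cut off a prescribed area\<close>

text \<open>The interior of \<open>T\<close> has points below \<open>s\<close> and points at or
  above \<open>s'\<close>. Being convex it is connected, so it meets the open slab between the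
  levels; this open set has positive measure and is lost on passing from \<open>s\<close> to
  \<open>s'\<close>.\<close>

lemma measure_halfspace_strict:
  fixes T :: "'a::euclidean_space set"
  assumes T: "compact T" "convex T" and ss: "s < s'"
    and lo: "measure lebesgue (T \<inter> {x. s \<le> x \<bullet> u}) < measure lebesgue T"
    and hi: "0 < measure lebesgue (T \<inter> {x. s' \<le> x \<bullet> u})"
  shows "measure lebesgue (T \<inter> {x. s' \<le> x \<bullet> u}) < measure lebesgue (T \<inter> {x. s \<le> x \<bullet> u})"
proof -
  have cl: "T \<inter> {x. r \<le> x \<bullet> u} \<in> lmeasurable" for r
    using compact_wedge_cut[OF T(1), of u r u r]
    by (intro lmeasurable_compact) (simp add: wedge_cut_def Int_assoc)
  have neg: "negligible (frontier T)" by (rule negligible_convex_frontier[OF T(2)])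
  \<comment> \<open>Otherwise \<open>T\<close> would lie above \<open>s\<close> up to its frontier,
    which is null by convexity, against \<open>lo\<close>.\<close>
  have "\<exists>x\<in>interior T. x \<bullet> u < s"
  proof (rule ccontr)
    assume "\<not> ?thesis"
    then have "T \<subseteq> (T \<inter> {x. s \<le> x \<bullet> u}) \<union> frontier T"
      using closure_subset[of T] by (force simp: frontier_def)
    then have "measure lebesgue T \<le> measure lebesgue ((T \<inter> {x. s \<le> x \<bullet> u}) \<union> frontier T)"
      using T(1) cl neg
      by (intro measure_mono_fmeasurable) (auto intro: lmeasurable_compact fmeasurableD negligible_imp_measurable)
    also have "\<dots> = measure lebesgue (T \<inter> {x. s \<le> x \<bullet> u})"
      using neg cl by (simp add: fmeasurableD measure_Un_null_set negligible_iff_null_sets)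
    finally show False using lo by simp
  qed
  then obtain x where x: "x \<in> interior T" "x \<bullet> u < s" by blast
  have "\<exists>y\<in>interior T. s' \<le> y \<bullet> u"
  proof (rule ccontr)
    assume "\<not> ?thesis"
    then have "T \<inter> {x. s' \<le> x \<bullet> u} \<subseteq> frontier T"
      using closure_subset[of T] by (force simp: frontier_def)
    then have "negligible (T \<inter> {x. s' \<le> x \<bullet> u})" using neg negligible_subset by blast
    then show False using hi negligible_imp_measure0 by fastforce
  qed
  then obtain y where y: "y \<in> interior T" "s' \<le> y \<bullet> u" by blast
  have "connected ((\<lambda>z. z \<bullet> u) ` interior T)"
    by (intro connected_continuous_image continuous_intros convex_connected convex_interior T)
  then have "(s + s') / 2 \<in> (\<lambda>z. z \<bullet> u) ` interior T"
    by (rule connectedD_interval[of _ "x \<bullet> u" "y \<bullet> u"]) (use x y ss in auto)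
  then obtain z where z: "z \<in> interior T" "z \<bullet> u = (s + s') / 2" by auto
  let ?O = "interior T \<inter> {z. s < z \<bullet> u} \<inter> {z. z \<bullet> u < s'}"
  have "open ?O"
    by (intro open_Int open_interior open_Collect_less continuous_intros)
  moreover have "?O \<noteq> {}" using z ss by auto
  ultimately have "\<not> negligible ?O" by (rule open_not_negligible)
  have "?O \<in> lmeasurable"
    using \<open>open ?O\<close> compact_imp_bounded[OF T(1)] interior_subset
    by (intro lmeasurable_open) (auto intro: bounded_subset)
  then have pos: "0 < measure lebesgue ?O"
    using \<open>\<not> negligible ?O\<close> by (simp add: negligible_iff_measure zero_less_measure_iff)
  have "measure lebesgue (T \<inter> {x. s' \<le> x \<bullet> u}) + measure lebesgue ?O
      = measure lebesgue ((T \<inter> {x. s' \<le> x \<bullet> u}) \<union> ?O)"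
  proof -
    have "(T \<inter> {x. s' \<le> x \<bullet> u}) \<inter> ?O = {}" by auto
    then show ?thesis using measure_Un3[OF cl \<open>?O \<in> lmeasurable\<close>, of s'] by simp
  qed
  also have "\<dots> \<le> measure lebesgue (T \<inter> {x. s \<le> x \<bullet> u})"
    using cl \<open>?O \<in> lmeasurable\<close> interior_subset ss
    by (intro measure_mono_fmeasurable) (auto intro: fmeasurableD)
  finally show ?thesis using pos by simp
qed

lemma measure_halfspace_antimono:
  fixes T :: "'a::euclidean_space set"
  assumes T: "compact T" and ss: "s \<le> s'"
  shows "measure lebesgue (T \<inter> {x. s' \<le> x \<bullet> u}) \<le> measure lebesgue (T \<inter> {x. s \<le> x \<bullet> u})"
proof -
  have cl: "T \<inter> {x. r \<le> x \<bullet> u} \<in> lmeasurable" for r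
    using compact_wedge_cut[OF T(1), of u r u r]
    by (intro lmeasurable_compact) (simp add: wedge_cut_def Int_assoc)
  show ?thesis using ss by (intro measure_mono_fmeasurable fmeasurableD cl) auto
qed

lemma continuous_on_measure_halfspace:
  fixes T :: "'a::euclidean_space set" and u :: "'b::metric_space \<Rightarrow> 'a"
  assumes "compact T" "continuous_on S u" "continuous_on S m" "\<And>s. s \<in> S \<Longrightarrow> u s \<noteq> 0"
  shows "continuous_on S (\<lambda>s. measure lebesgue (T \<inter> {x. m s \<le> x \<bullet> u s}))"
  \<comment> \<open>A half-space is a wedge whose two conditions coincide.\<close>
  using continuous_on_measure_wedge_cut[OF assms(1,2,2,3,3,4,4)]
  by (simp add: wedge_cut_def Int_assoc)

text \<open>Intermediate value theorem in the level: below all of \<open>T\<close> the area is full,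
  above all of \<open>T\<close> it is zero.\<close>

lemma halfspace_level_exists:
  fixes T :: "'a::euclidean_space set"
  assumes T: "compact T" and u: "u \<noteq> 0" and \<alpha>: "0 \<le> \<alpha>" "\<alpha> \<le> measure lebesgue T"
  shows "\<exists>s. measure lebesgue (T \<inter> {x. s \<le> x \<bullet> u}) = \<alpha>"
proof -
  have "bounded ((\<lambda>x. x \<bullet> u) ` T)"
    by (intro compact_imp_bounded compact_continuous_image continuous_intros T)
  then obtain K where K: "\<And>x. x \<in> T \<Longrightarrow> \<bar>x \<bullet> u\<bar> < K" "K > 0"
    unfolding bounded_pos_less by auto
  have "T \<inter> {x. - K \<le> x \<bullet> u} = T" "T \<inter> {x. K \<le> x \<bullet> u} = {}"
    using K(1) by fastforce+
  moreover have "continuous_on {-K..K} (\<lambda>s. measure lebesgue (T \<inter> {x. s \<le> x \<bullet> u}))"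
    using u by (intro continuous_on_measure_halfspace T continuous_intros) auto
  ultimately show ?thesis
    using IVT2'[of "\<lambda>s. measure lebesgue (T \<inter> {x. s \<le> x \<bullet> u})" K \<alpha> "-K"] \<alpha> K(2) by auto
qed

text \<open>As \<alpha> is strictly between zero and the full area, the level is unique. If
  \<open>a\<close> is on one side of \<open>h r\<close>, strict monotonicity separates the area at
  level \<open>a\<close> from \<alpha>; this persists for \<open>s\<close> near \<open>r\<close> and
  keeps \<open>h s\<close> on the same side of \<open>a\<close>.\<close>

lemma continuous_on_halfspace_level:
  fixes T :: "'a::euclidean_space set" and u :: "'b::metric_space \<Rightarrow> 'a"
  assumes T: "compact T" "convex T" and u: "continuous_on S u" "\<And>s. s \<in> S \<Longrightarrow> u s \<noteq> 0"
    and \<alpha>: "0 < \<alpha>" "\<alpha> < measure lebesgue T"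
    and h: "\<And>s. s \<in> S \<Longrightarrow> measure lebesgue (T \<inter> {x. h s \<le> x \<bullet> u s}) = \<alpha>"
  shows "continuous_on S h"
  unfolding continuous_on_def
proof
  fix r assume r: "r \<in> S"
  let ?F = "\<lambda>s a. measure lebesgue (T \<inter> {x. a \<le> x \<bullet> u s})"
  have lim: "((\<lambda>s. ?F s a) \<longlongrightarrow> ?F r a) (at r within S)" for a
    using continuous_on_measure_halfspace[OF T(1) u(1) continuous_on_const u(2)] r
    unfolding continuous_on_def by blast
  have S: "\<forall>\<^sub>F s in at r within S. s \<in> S"
    by (simp add: eventually_at_filter)
  show "(h \<longlongrightarrow> h r) (at r within S)"
  proof (rule order_tendstoI)
    fix a assume a: "a < h r"
    have "\<alpha> < ?F r a"
      using measure_halfspace_strict[OF T a, of "u r"] h[OF r] \<alpha> by force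
    from order_tendstoD(1)[OF lim this] S
    show "\<forall>\<^sub>F s in at r within S. a < h s"
    proof eventually_elim
      case (elim s)
      then show ?case
        using measure_halfspace_antimono[OF T(1), of "h s" a "u s"] h[of s] by force
    qed
  next
    fix a assume a: "h r < a"
    \<comment> \<open>Strict monotonicity asks for positive area above \<open>a\<close>; zero area
      is below \<alpha> at once.\<close>
    have "?F r a < \<alpha>"
      using measure_halfspace_strict[OF T a, of "u r"] h[OF r] \<alpha>
      by (cases "?F r a = 0") (auto simp: zero_less_measure_iff)
    from order_tendstoD(2)[OF lim this] S
    show "\<forall>\<^sub>F s in at r within S. h s < a"
    proof eventually_elim
      case (elim s)
      then show ?case
        using measure_halfspace_antimono[OF T(1), of a "h s" "u s"] h[of s] by force
    qed
  qed
qed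

section \<open>Reflections and the bias of a cap at a side\<close>

lemma orthogonal_transformation_reflection:
  fixes u :: "'a::euclidean_space"
  shows "orthogonal_transformation (\<lambda>x. x - (2 * (x \<bullet> u) / (u \<bullet> u)) *\<^sub>R u)"
proof (cases "u = 0")
  case False
  have "(x - (2 * (x \<bullet> u) / (u \<bullet> u)) *\<^sub>R u) \<bullet> (y - (2 * (y \<bullet> u) / (u \<bullet> u)) *\<^sub>R u) = x \<bullet> y" for x y
    using False by (simp add: inner_diff_left inner_diff_right inner_commute[of u y])
  moreover have "linear (\<lambda>x. x - (2 * (x \<bullet> u) / (u \<bullet> u)) *\<^sub>R u)"
    by (rule linearI)
      (simp_all add: inner_add_left add_divide_distrib scaleR_left_distrib scaleR_right_diff_distrib distrib_left)
  ultimately show ?thesis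
    by (simp add: orthogonal_transformation_def)
\<comment> \<open>For \<open>u = 0\<close> the quotient is zero, and the map is the
  identity.\<close>
qed (simp add: orthogonal_transformation_def linear_id[unfolded id_def])

text \<open>For nonzero \<open>u\<close> the map in \<open>sub\<close> is the reflection in the line
  at level \<open>m\<close> normal to \<open>u\<close>: a linear reflection followed by a
  translation, hence area preserving.\<close>

lemma measure_le_if_reflection_subset:
  fixes u :: "real ^ 2"
  assumes S: "S \<in> lmeasurable" and S': "S' \<in> lmeasurable"
    and sub: "\<And>x. x \<in> S \<Longrightarrow> x - (2 * (x \<bullet> u - m) / (u \<bullet> u)) *\<^sub>R u \<in> S'"
  shows "measure lebesgue S \<le> measure lebesgue S'"
proof -
  let ?f = "\<lambda>x. x - (2 * (x \<bullet> u) / (u \<bullet> u)) *\<^sub>R u"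
  let ?g = "\<lambda>x. (2 * m / (u \<bullet> u)) *\<^sub>R u + x"
  have f: "orthogonal_transformation ?f"
    by (rule orthogonal_transformation_reflection)
  have m: "?g ` ?f ` S \<in> lmeasurable"
    by (intro measurable_translation measurable_orthogonal_image[OF f] S)
  have "measure lebesgue S = measure lebesgue (?g ` ?f ` S)"
    by (simp only: measure_translation measure_orthogonal_image[OF f S])
  also have "\<dots> \<le> measure lebesgue S'"
  proof (rule measure_mono_fmeasurable[OF _ fmeasurableD[OF m] S'])
    show "?g ` ?f ` S \<subseteq> S'"
    proof clarify
      fix x assume "x \<in> S"
      have e: "?g (?f x) = x - (2 * (x \<bullet> u - m) / (u \<bullet> u)) *\<^sub>R u"
        by (simp add: algebra_simps diff_divide_distrib)
      show "?g (?f x) \<in> S'" unfolding e by (rule sub[OF \<open>x \<in> S\<close>])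
    qed
  qed
  finally show ?thesis .
qed


text \<open>
  The midpoints of the chords parallel to \<open>PQ\<close> move monotonically towards \<open>P\<close> on the way to \<open>R\<close>.
  So, with respect to the halving line, either all chords in the cap at \<open>PQ\<close> have their midpoint
  on the side of \<open>Q\<close>, or all chords outside the cap have it on the side of \<open>P\<close>. Reflection in the
  halving line then maps one half of that part of the triangle into the other half.
\<close>

lemma triangle_cap_biased:
  fixes P Q R v :: "real ^ 2"
  defines "u \<equiv> Q - P" and "T \<equiv> convex hull {P, Q, R}"
  assumes PQ: "P \<noteq> Q" and v: "u \<bullet> v = 0" and R: "R \<bullet> v < P \<bullet> v"
    and near: "(R - P) \<bullet> u \<le> (Q - R) \<bullet> u"
    and half: "measure lebesgue (T \<inter> {x. m \<le> x \<bullet> u}) = measure lebesgue T / 2"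
  shows "measure lebesgue (wedge_cut T (- u) (- m) v k) \<le> measure lebesgue (wedge_cut T u m v k)"
proof -
  have T: "compact T"
    unfolding T_def by (intro finite_imp_compact_convex_hull) simp
  have meas: "wedge_cut T w i w' j \<in> lmeasurable" for w i w' j
    by (intro lmeasurable_compact compact_wedge_cut T)
  have uu: "u \<bullet> u > 0" using PQ by (simp add: u_def)
  then have u0: "u \<noteq> 0" by auto
  have v0: "v \<noteq> 0" using R by auto
  have Qv: "Q \<bullet> v = P \<bullet> v" using v by (simp add: u_def inner_diff_left)
  \<comment> \<open>\<open>M\<close> is the \<open>u\<close>-coordinate of the midpoint of
    \<open>PQ\<close>, and \<open>mid c\<close> that of the midpoint of the chord on which
    \<open>R\<close> has barycentric weight \<open>c\<close>. By \<open>near\<close>, it decreases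
    in \<open>c\<close>.\<close>
  define M where "M = (P + Q) \<bullet> u / 2"
  define mid where "mid c = (1 - c) * M + c * (R \<bullet> u)" for c
  have near': "R \<bullet> u \<le> M"
    using near by (simp add: M_def inner_diff_left inner_add_left)
  have mid_mono: "mid c' \<le> mid c" if "c \<le> c'" for c c'
  proof -
    have "mid c - mid c' = (c' - c) * (M - R \<bullet> u)"
      by (simp add: mid_def algebra_simps)
    also have "\<dots> \<ge> 0" using that near' by simp
    finally show ?thesis by simp
  qed
  let ?r = "\<lambda>x. x - (2 * (x \<bullet> u - m) / (u \<bullet> u)) *\<^sub>R u"
  have ru: "?r x \<bullet> u = 2 * m - x \<bullet> u" for x
    using uu by (simp add: inner_diff_left)
  have rv: "?r x \<bullet> v = x \<bullet> v" for x
    using v by (simp add: inner_diff_left)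
  \<comment> \<open>In barycentric coordinates the height along \<open>v\<close> depends on
    \<open>c\<close> alone, and \<open>a - b\<close> measures the offset from the midpoint of the
    chord.\<close>
  have coords: "\<exists>a b c. x = a *\<^sub>R P + b *\<^sub>R Q + c *\<^sub>R R \<and> 0 \<le> a \<and> 0 \<le> b \<and> 0 \<le> c \<and> a + b + c = 1 \<and>
      x \<bullet> v = P \<bullet> v - c * (P \<bullet> v - R \<bullet> v) \<and> x \<bullet> u = mid c - (a - b) / 2 * (u \<bullet> u)" if x_in: "x \<in> T" for x
  proof -
    obtain a b c where x: "x = a *\<^sub>R P + b *\<^sub>R Q + c *\<^sub>R R" "0 \<le> a" "0 \<le> b" "0 \<le> c" "a + b + c = 1"
      using x_in unfolding T_def convex_hull_3 by blast
    have a: "a = 1 - b - c" using x(5) by simp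
    have "x \<bullet> v = P \<bullet> v - c * (P \<bullet> v - R \<bullet> v)"
      by (simp add: x(1) a inner_add_left Qv algebra_simps)
    moreover have "u \<bullet> u = Q \<bullet> u - P \<bullet> u" by (simp add: u_def inner_diff_left)
    then have "x \<bullet> u = mid c - (a - b) / 2 * (u \<bullet> u)"
      by (simp add: x(1) a mid_def M_def inner_add_left) (simp add: field_simps)
    ultimately show ?thesis using x by blast
  qed
  \<comment> \<open>Since \<open>u = Q - P\<close>, subtracting \<open>q *\<^sub>R u\<close> moves
    weight \<open>q\<close> from \<open>Q\<close> to \<open>P\<close>.\<close>
  have shift: "x - q *\<^sub>R u \<in> T" if "x = a *\<^sub>R P + b *\<^sub>R Q + c *\<^sub>R R" "0 \<le> c" "a + b + c = 1"
      "0 \<le> a + q" "0 \<le> b - q" for x a b c q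
  proof -
    have "x - q *\<^sub>R u = (a + q) *\<^sub>R P + (b - q) *\<^sub>R Q + c *\<^sub>R R"
      by (simp add: that(1) u_def scaleR_add_left scaleR_diff_left scaleR_diff_right)
    moreover have "(a + q) + (b - q) + c = 1" using that(3) by simp
    ultimately show ?thesis
      unfolding T_def convex_hull_3 using that(2,4,5) by blast
  qed
  \<comment> \<open>The weight of \<open>R\<close> on the line bounding the cap; the cap is given by
    \<open>c \<le> c0\<close>.\<close>
  define c0 where "c0 = (P \<bullet> v - k) / (P \<bullet> v - R \<bullet> v)"
  have level: "k \<le> P \<bullet> v - c * (P \<bullet> v - R \<bullet> v) \<longleftrightarrow> c \<le> c0" "P \<bullet> v - c * (P \<bullet> v - R \<bullet> v) \<le> k \<longleftrightarrow> c0 \<le> c" for c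
    using R by (auto simp: c0_def field_simps)
  show ?thesis
  proof (cases "m \<le> mid c0")
    case True
    show ?thesis
    proof (rule measure_le_if_reflection_subset[OF meas meas, where u = u and m = m])
      fix x assume "x \<in> wedge_cut T (- u) (- m) v k"
      then have x: "x \<in> T" "x \<bullet> u \<le> m" "k \<le> x \<bullet> v" by (auto simp: wedge_cut_def)
      obtain a b c where abc: "x = a *\<^sub>R P + b *\<^sub>R Q + c *\<^sub>R R" "0 \<le> a" "0 \<le> b" "0 \<le> c" "a + b + c = 1"
        "x \<bullet> v = P \<bullet> v - c * (P \<bullet> v - R \<bullet> v)" "x \<bullet> u = mid c - (a - b) / 2 * (u \<bullet> u)"
        using coords[OF x(1)] by blast
      have "m \<le> mid c" using True mid_mono[of c c0] x(3) level(1) abc(6) by simp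
      \<comment> \<open>For the weight \<open>q\<close> moved by the reflection,
        \<open>b - a \<le> q \<le> 0\<close> makes both new weights \<open>a + q\<close> and
        \<open>b - q\<close> at least \<open>b\<close>.\<close>
      then have "2 * (x \<bullet> u - m) / (u \<bullet> u) \<ge> b - a"
        using abc(7) uu by (simp add: field_simps)
      moreover have "2 * (x \<bullet> u - m) / (u \<bullet> u) \<le> 0"
        using x(2) uu by (simp add: divide_le_0_iff)
      ultimately have "?r x \<in> T"
        using abc by (intro shift[of x a b c]) auto
      then show "?r x \<in> wedge_cut T u m v k"
        using x ru[of x] rv[of x] by (simp add: wedge_cut_def)
    qed
  next
    case False
    \<comment> \<open>Now the chords outside the cap have their midpoints on the side of
      \<open>P\<close>, so the reflection is applied there, from the side of
      \<open>Q\<close>.\<close>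
    have le: "measure lebesgue (wedge_cut T u m (- v) (- k)) \<le> measure lebesgue (wedge_cut T (- u) (- m) (- v) (- k))"
    proof (rule measure_le_if_reflection_subset[OF meas meas, where u = u and m = m])
      fix x assume "x \<in> wedge_cut T u m (- v) (- k)"
      then have x: "x \<in> T" "m \<le> x \<bullet> u" "x \<bullet> v \<le> k" by (auto simp: wedge_cut_def)
      obtain a b c where abc: "x = a *\<^sub>R P + b *\<^sub>R Q + c *\<^sub>R R" "0 \<le> a" "0 \<le> b" "0 \<le> c" "a + b + c = 1"
        "x \<bullet> v = P \<bullet> v - c * (P \<bullet> v - R \<bullet> v)" "x \<bullet> u = mid c - (a - b) / 2 * (u \<bullet> u)"
        using coords[OF x(1)] by blast
      have "mid c \<le> m" using False mid_mono[of c0 c] x(3) level(2) abc(6) by simp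
      then have "2 * (x \<bullet> u - m) / (u \<bullet> u) \<le> b - a"
        using abc(7) uu by (simp add: field_simps)
      moreover have "2 * (x \<bullet> u - m) / (u \<bullet> u) \<ge> 0"
        using x(2) uu by simp
      ultimately have "?r x \<in> T"
        using abc by (intro shift[of x a b c]) auto
      then show "?r x \<in> wedge_cut T (- u) (- m) (- v) (- k)"
        using x ru[of x] rv[of x] by (simp add: wedge_cut_def)
    qed
    \<comment> \<open>Both sides of the halving line have equal area, so the inequality outside the
      cap reverses inside it.\<close>
    have "measure lebesgue (wedge_cut T u m v k) + measure lebesgue (wedge_cut T u m (- v) (- k)) = measure lebesgue T / 2"
      using measure_wedge_cut_split[OF T v0, of k u m] half by (simp add: wedge_cut_commute[of T u])
    moreover have "measure lebesgue (wedge_cut T (- u) (- m) v k) + measure lebesgue (wedge_cut T (- u) (- m) (- v) (- k))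
        = measure lebesgue (T \<inter> {x. - m \<le> x \<bullet> (- u)})"
      using measure_wedge_cut_split[OF T v0, of k "- u" "- m"] by (simp add: wedge_cut_commute[of T "- u"])
    moreover have "measure lebesgue (T \<inter> {x. m \<le> x \<bullet> u}) + measure lebesgue (T \<inter> {x. - m \<le> x \<bullet> (- u)}) = measure lebesgue T"
      using measure_wedge_cut_split[OF T u0, of m 0 0] by (simp add: wedge_cut_def)
    ultimately show ?thesis using le half by linarith
  qed
qed

section \<open>Rotation by a right angle and orientation\<close>

definition perp :: "real ^ 2 \<Rightarrow> real ^ 2" where
  "perp x = vector [- x $ 2, x $ 1]"

lemma perp_nth [simp]: "perp x $ 1 = - x $ 2" "perp x $ 2 = x $ 1"
  by (simp_all add: perp_def)

lemma inner_real2: "x \<bullet> y = x $ 1 * y $ 1 + x $ 2 * y $ 2" for x y :: "real ^ 2"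
  by (simp add: inner_vec_def sum_2)

lemma linear_perp: "linear perp"
  by (rule linearI) (simp_all add: vec_eq_iff forall_2)

lemma inner_perp_self [simp]: "x \<bullet> perp x = 0" "perp x \<bullet> x = 0"
  by (simp_all add: inner_real2)

lemma perp_eq_0_iff [simp]: "perp x = 0 \<longleftrightarrow> x = 0"
  by (auto simp: vec_eq_iff forall_2)

text \<open>The inner product is, up to sign, twice the signed area of the triangle. If it vanishes,
  \<open>A - B\<close> equals its projection onto \<open>C - B\<close>.\<close>

lemma collinear_if_perp_inner_eq_0:
  assumes "perp (C - B) \<bullet> (B - A) = 0"
  shows "collinear {A, B, C}"
proof (cases "C = B")
  case False
  let ?u = "C - B"
  have n: "?u \<bullet> ?u \<noteq> 0" using False by simp
  have "(?u \<bullet> ?u) *\<^sub>R (A - B) = ((A - B) \<bullet> ?u) *\<^sub>R ?u"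
    using assms by (simp add: vec_eq_iff forall_2 inner_real2) algebra
  then have "inverse (?u \<bullet> ?u) *\<^sub>R ((?u \<bullet> ?u) *\<^sub>R (A - B)) = inverse (?u \<bullet> ?u) *\<^sub>R (((A - B) \<bullet> ?u) *\<^sub>R ?u)"
    by (rule arg_cong)
  then have "A - B = (inverse (?u \<bullet> ?u) * ((A - B) \<bullet> ?u)) *\<^sub>R ?u"
    using n by (simp only: scaleR_scaleR) simp
  then have "collinear {0, C - B, A - B}"
    unfolding collinear_lemma by blast
  then have "collinear {C, B, A}"
    by (simp add: collinear_3)
  then show ?thesis by (simp add: insert_commute)
qed simp

section \<open>The intermediate value argument\<close>

text \<open>By \<open>orient\<close> the vertices \<open>A\<close>, \<open>B\<close>,
  \<open>C\<close> run clockwise, so \<open>perp\<close> turns \<open>C - B\<close> and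
  \<open>A - C\<close> into outward normals and the cap starts at \<open>BC\<close> and ends at
  \<open>CA\<close>.\<close>

lemma oriented_triangle_halving_cut:
  fixes A B C :: "real ^ 2"
  defines "T \<equiv> convex hull {A, B, C}"
  assumes orient: "perp (C - B) \<bullet> (B - A) > 0"
    and long: "dist B C \<le> dist A B" "dist A C \<le> dist A B"
    and T1: "measure lebesgue T = 1" and t: "0 < t" "t \<le> 1 / 4"
  shows "\<exists>u m k. u \<noteq> 0 \<and>
    measure lebesgue (T \<inter> {x. m \<le> x \<bullet> u}) = 1 / 2 \<and>
    measure lebesgue (T \<inter> {x. k \<le> x \<bullet> perp u}) = 2 * t \<and>
    measure lebesgue (wedge_cut T u m (perp u) k) = t"
proof -
  have T: "compact T" "convex T"
    unfolding T_def by (intro finite_imp_compact_convex_hull; simp) simp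
  define u where "u s = (1 - s) *\<^sub>R (C - B) + s *\<^sub>R (A - C)" for s
  have u01: "u 0 = C - B" "u 1 = A - C" by (simp_all add: u_def)
  have orient': "perp (A - C) \<bullet> (C - B) = perp (C - B) \<bullet> (B - A)"
    by (simp add: inner_real2 algebra_simps)
  \<comment> \<open>The two side vectors are independent: pairing with their normals would force
    both \<open>s = 0\<close> and \<open>s = 1\<close>.\<close>
  have unz: "u s \<noteq> 0" for s
  proof
    assume "u s = 0"
    moreover have "u s \<bullet> perp (C - B) = - s * (perp (C - B) \<bullet> (B - A))"
      "u s \<bullet> perp (A - C) = (1 - s) * (perp (C - B) \<bullet> (B - A))"
      by (simp_all add: u_def inner_real2 algebra_simps)
    ultimately show False using orient by auto
  qed
  have ucont: "continuous_on S u" for S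
    unfolding u_def by (intro continuous_intros)
  have vcont: "continuous_on S (\<lambda>s. perp (u s))" for S
    using linear_perp ucont by (rule linear_continuous_on_compose[rotated])
  have "\<exists>m. measure lebesgue (T \<inter> {x. m \<le> x \<bullet> u s}) = 1 / 2" for s
    using halfspace_level_exists[OF T(1) unz, of "1/2" s] T1 by simp
  then obtain m where m: "\<And>s. measure lebesgue (T \<inter> {x. m s \<le> x \<bullet> u s}) = 1 / 2" by metis
  have "\<exists>k. measure lebesgue (T \<inter> {x. k \<le> x \<bullet> perp (u s)}) = 2 * t" for s
    using t T1 unz by (intro halfspace_level_exists[OF T(1)]) auto
  then obtain k where k: "\<And>s. measure lebesgue (T \<inter> {x. k s \<le> x \<bullet> perp (u s)}) = 2 * t" by metis
  let ?g = "\<lambda>s. measure lebesgue (wedge_cut T (u s) (m s) (perp (u s)) (k s))"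
  \<comment> \<open>The levels were merely chosen; they are continuous because 1/2 and
    \<open>2 * t\<close> lie strictly between 0 and 1.\<close>
  have mcont: "continuous_on UNIV m"
    using m T1 by (intro continuous_on_halfspace_level[OF T ucont unz, where \<alpha> = "1/2"]) auto
  have kcont: "continuous_on UNIV k"
    using k T1 t unz by (intro continuous_on_halfspace_level[OF T vcont, where \<alpha> = "2*t"]) auto
  have gcont: "continuous_on UNIV ?g"
    using unz by (intro continuous_on_measure_wedge_cut T ucont vcont mcont kcont) auto
  have split: "?g s + measure lebesgue (wedge_cut T (- u s) (- m s) (perp (u s)) (k s)) = 2 * t" for s
    using measure_wedge_cut_split[OF T(1) unz] k by simp
  have half: "measure lebesgue (T \<inter> {x. - m s \<le> x \<bullet> (- u s)}) = 1 / 2" for s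
    using measure_wedge_cut_split[OF T(1) unz[of s], of "m s" 0 0] m[of s] T1 by (simp add: wedge_cut_def)
  have hull: "convex hull {C, B, A} = T" "convex hull {C, A, B} = T"
    unfolding T_def by (simp_all add: insert_commute)
  have sq: "(B - C) \<bullet> (B - C) \<le> (A - B) \<bullet> (A - B)" "(A - C) \<bullet> (A - C) \<le> (A - B) \<bullet> (A - B)"
    using long by (simp_all add: dist_norm norm_le)
  \<comment> \<open>At \<open>s = 0\<close> the larger half of the cap lies towards
    \<open>B\<close>. The direction \<open>B - C\<close> is \<open>- u 0\<close>, hence the negated
    level.\<close>
  have "measure lebesgue (wedge_cut T (- (B - C)) (- (- m 0)) (perp (u 0)) (k 0))
      \<le> measure lebesgue (wedge_cut T (B - C) (- m 0) (perp (u 0)) (k 0))"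
    unfolding hull(1)[symmetric]
  proof (rule triangle_cap_biased)
    show "C \<noteq> B" using orient by (auto simp: inner_real2)
    show "(B - C) \<bullet> perp (u 0) = 0"
      by (simp add: u01 inner_real2 algebra_simps)
    show "A \<bullet> perp (u 0) < C \<bullet> perp (u 0)"
      using orient by (simp add: u01 inner_real2 algebra_simps)
    \<comment> \<open>The difference of the two sides is
      \<open>(A - C) \<bullet> (A - C) - (A - B) \<bullet> (A - B)\<close>, so this says that
      \<open>AC\<close> is no longer than \<open>AB\<close>.\<close>
    show "(A - C) \<bullet> (B - C) \<le> (B - A) \<bullet> (B - C)"
      using sq(2) by (simp add: inner_real2 algebra_simps)
    show "measure lebesgue (convex hull {C, B, A} \<inter> {x. - m 0 \<le> x \<bullet> (B - C)}) =
      measure lebesgue (convex hull {C, B, A}) / 2"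
      using half[of 0] by (simp add: u01 hull T1)
  qed
  then have g0: "?g 0 \<le> t"
    using split[of 0] by (simp add: u01)
  have "measure lebesgue (wedge_cut T (- (A - C)) (- m 1) (perp (u 1)) (k 1))
      \<le> measure lebesgue (wedge_cut T (A - C) (m 1) (perp (u 1)) (k 1))"
    unfolding hull(2)[symmetric]
  proof (rule triangle_cap_biased)
    show "C \<noteq> A" using orient orient' by (auto simp: inner_real2)
    show "(A - C) \<bullet> perp (u 1) = 0"
      by (simp add: u01)
    show "B \<bullet> perp (u 1) < C \<bullet> perp (u 1)"
      using orient by (simp add: u01 inner_real2 algebra_simps)
    show "(B - C) \<bullet> (A - C) \<le> (A - B) \<bullet> (A - C)"
      using sq(1) by (simp add: inner_real2 algebra_simps)
    show "measure lebesgue (convex hull {C, A, B} \<inter> {x. m 1 \<le> x \<bullet> (A - C)}) =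
      measure lebesgue (convex hull {C, A, B}) / 2"
      using m[of 1] by (simp add: u01 hull T1)
  qed
  then have g1: "t \<le> ?g 1"
    using split[of 1] by (simp add: u01)
  obtain s where "?g s = t"
    using IVT'[of ?g 0 t 1, OF g0 g1] continuous_on_subset[OF gcont] by auto
  then show ?thesis using unz m k by blast
qed

section \<open>From half-plane areas to the four pieces\<close>

lemma orthogonal_cut_wedge_cut:
  assumes "u \<noteq> 0" "v \<noteq> 0" "u \<bullet> v = 0"
  shows "\<exists>L M. orthogonal_cut T L M (wedge_cut T u m v k) (wedge_cut T (- u) (- m) v k)
    (wedge_cut T (- u) (- m) (- v) (- k)) (wedge_cut T u m (- v) (- k))"
proof -
  \<comment> \<open>By orthogonality, the point where the lines at levels \<open>m\<close> and
    \<open>k\<close> meet.\<close>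
  define p where "p = (m / (u \<bullet> u)) *\<^sub>R u + (k / (v \<bullet> v)) *\<^sub>R v"
  have p: "p \<bullet> u = m" "p \<bullet> v = k"
    using assms by (simp_all add: p_def inner_add_left inner_commute[of v u])
  show ?thesis
    unfolding orthogonal_cut_def
    by (rule exI[of _ "line p u"], rule exI[of _ "line p v"], rule exI[of _ p], rule exI[of _ u], rule exI[of _ v])
      (use assms p in \<open>auto simp: orthogonal_def wedge_cut_def quadrant_def inner_diff_left\<close>)
qed

text \<open>The areas of the half, the cap and their common corner determine the other three pieces
  by subtraction.\<close>

lemma orthogonal_cut_exists:
  fixes T :: "(real ^ 2) set"
  assumes T: "compact T" and T1: "measure lebesgue T = 1" and uv: "u \<noteq> 0" "v \<noteq> 0" "u \<bullet> v = 0"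
    and half: "measure lebesgue (T \<inter> {x. m \<le> x \<bullet> u}) = 1 / 2"
    and cap: "measure lebesgue (T \<inter> {x. k \<le> x \<bullet> v}) = 2 * t"
    and corner: "measure lebesgue (wedge_cut T u m v k) = t"
  shows "\<exists>L M A B C D. orthogonal_cut T L M A B C D \<and>
           measure lebesgue A = t \<and> measure lebesgue B = t \<and>
           measure lebesgue C = 1 / 2 - t \<and> measure lebesgue D = 1 / 2 - t"
proof -
  have B: "measure lebesgue (wedge_cut T (- u) (- m) v k) = t"
    using measure_wedge_cut_split[OF T uv(1), of m v k] cap corner by simp
  have D: "measure lebesgue (wedge_cut T u m (- v) (- k)) = 1 / 2 - t"
    using measure_wedge_cut_split[OF T uv(2), of k u m] half corner by (simp add: wedge_cut_commute[of T u])
  have cap': "measure lebesgue (T \<inter> {x. - k \<le> x \<bullet> (- v)}) = 1 - 2 * t"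
    using measure_wedge_cut_split[OF T uv(2), of k 0 0] cap T1 by (simp add: wedge_cut_def)
  have C: "measure lebesgue (wedge_cut T (- u) (- m) (- v) (- k)) = 1 / 2 - t"
    using measure_wedge_cut_split[OF T uv(1), of m "- v" "- k"] cap' D by simp
  show ?thesis
    using orthogonal_cut_wedge_cut[OF uv, of T m k] corner B C D by blast
qed

text \<open>Exchanging \<open>A\<close> and \<open>B\<close> reverses the orientation and keeps
  \<open>AB\<close> a longest side, so the oriented case suffices.\<close>

lemma triangle_halving_cut:
  fixes A B C :: "real ^ 2"
  assumes nc: "\<not> collinear {A, B, C}" and T: "T = convex hull {A, B, C}"
    and long: "dist B C \<le> dist A B" "dist A C \<le> dist A B"
    and T1: "measure lebesgue T = 1" and t: "0 < t" "t \<le> 1 / 4"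
  shows "\<exists>u m k. u \<noteq> 0 \<and>
    measure lebesgue (T \<inter> {x. m \<le> x \<bullet> u}) = 1 / 2 \<and>
    measure lebesgue (T \<inter> {x. k \<le> x \<bullet> perp u}) = 2 * t \<and>
    measure lebesgue (wedge_cut T u m (perp u) k) = t"
proof -
  have T': "T = convex hull {B, A, C}" by (simp add: T insert_commute)
  have "perp (C - B) \<bullet> (B - A) \<noteq> 0"
    using nc collinear_if_perp_inner_eq_0 by blast
  moreover have "perp (C - A) \<bullet> (A - B) = - (perp (C - B) \<bullet> (B - A))"
    by (simp add: inner_real2 algebra_simps)
  ultimately consider "perp (C - B) \<bullet> (B - A) > 0" | "perp (C - A) \<bullet> (A - B) > 0"
    by linarith
  then show ?thesis
  proof cases
    case 1
    then show ?thesis using oriented_triangle_halving_cut[of C B A t] long T1 t unfolding T by blast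
  next
    case 2
    then show ?thesis using oriented_triangle_halving_cut[of C A B t] long T1 t unfolding T' by (simp add: dist_commute)
  qed
qed

theorem corollary7p2:
  fixes a b c :: "real ^ 2" and T :: "(real ^ 2) set" and t :: real
  assumes "\<not> collinear {a, b, c}"
    and "T = convex hull {a, b, c}"
    and "measure lebesgue T = 1"
    and "0 \<le> t" and "t \<le> 1 / 4"
  shows "\<exists>L M A B C D. orthogonal_cut T L M A B C D \<and>
           measure lebesgue A = t \<and> measure lebesgue B = t \<and>
           measure lebesgue C = 1 / 2 - t \<and> measure lebesgue D = 1 / 2 - t"
proof -
  have T: "compact T"
    unfolding assms(2) by (intro finite_imp_compact_convex_hull) simp
  have "\<exists>u m k. u \<noteq> 0 \<and>
    measure lebesgue (T \<inter> {x. m \<le> x \<bullet> u}) = 1 / 2 \<and>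
    measure lebesgue (T \<inter> {x. k \<le> x \<bullet> perp u}) = 2 * t \<and>
    measure lebesgue (wedge_cut T u m (perp u) k) = t"
  proof (cases "t = 0")
    case True
    obtain u :: "real ^ 2" where u: "u \<noteq> 0" by (rule that[of "axis 1 1"]) (simp add: axis_eq_0_iff)
    obtain m where m: "measure lebesgue (T \<inter> {x. m \<le> x \<bullet> u}) = 1 / 2"
      using halfspace_level_exists[OF T u, of "1/2"] assms(3) by auto
    have "bounded ((\<lambda>x. x \<bullet> perp u) ` T)"
      by (intro compact_imp_bounded compact_continuous_image continuous_intros T)
    then obtain K where K: "\<And>x. x \<in> T \<Longrightarrow> \<bar>x \<bullet> perp u\<bar> < K"
      unfolding bounded_pos_less by auto
    then have e: "T \<inter> {x. K \<le> x \<bullet> perp u} = {}" by fastforce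
    then have "wedge_cut T u m (perp u) K = {}" by (auto simp: wedge_cut_def)
    then have "measure lebesgue (wedge_cut T u m (perp u) K) = t" by (simp add: True)
    moreover have "measure lebesgue (T \<inter> {x. K \<le> x \<bullet> perp u}) = 2 * t" by (simp add: e True)
    ultimately show ?thesis using u m by blast
  next
    case False
    \<comment> \<open>The vertices are relabelled cyclically so that a longest side comes
      first.\<close>
    consider "dist b c \<le> dist a b" "dist a c \<le> dist a b"
      | "dist c a \<le> dist b c" "dist b a \<le> dist b c"
      | "dist a b \<le> dist c a" "dist c b \<le> dist c a"
      by (smt (verit) dist_commute)
    then show ?thesis
    proof cases
      case 1
      then show ?thesis using triangle_halving_cut[of a b c T t] assms False by simp
    next
      case 2
      then show ?thesis using triangle_halving_cut[of b c a T t] assms False by (simp add: insert_commute)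
    next
      case 3
      then show ?thesis using triangle_halving_cut[of c a b T t] assms False by (simp add: insert_commute)
    qed
  qed
  then obtain u m k where u: "u \<noteq> 0"
    and cut: "measure lebesgue (T \<inter> {x. m \<le> x \<bullet> u}) = 1 / 2"
      "measure lebesgue (T \<inter> {x. k \<le> x \<bullet> perp u}) = 2 * t"
      "measure lebesgue (wedge_cut T u m (perp u) k) = t"
    by blast
  from u have "perp u \<noteq> 0" by simp
  then show ?thesis
    using u by (intro orthogonal_cut_exists[OF T assms(3) _ _ _ cut]) simp_all
qed

end
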